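(* The instance $(\theta,A,B(\cdot),Q,R,p)$ is uninformative if and only if there exists a vector $\tilde v\in\mathbb R^{d_\theta}$ such that $$\tilde v\in\ker L^\top\big[K(\theta)K(\theta)^\top\otimes\mathtt J(p)\big]L\qquad\text{and}\qquad\tilde v\notin\ker\mathsf D_\theta\mathrm{vec}K(\theta),$$ where $L$ is the matrix such that $\mathrm{vec}\,B(\theta)=L\theta+\mathrm{vec}\,B_0$.
   Context: Setting. $\Theta\subset\mathbb R^{d_\theta}$ is open and $\theta\in\Theta$. The controlled process on $\mathbb R^{d_x}$ is $x_{t+1}=Ax_t+B(\theta)u_t+w_t$, $x_0=0$, with $u_t\in\mathbb R^{d_u}$, $A\in\mathbb R^{d_x\times d_x}$, $B(\theta)\in\mathbb R^{d_x\times d_u}$, and stage cost $x^\top Qx+u^\top Ru$. Assumptions: (A1) $\{w_t\}$ is i.i.d. with density $p\in C^1(\mathbb R^{d_x})$, $\mathbf Ew_tw_t^\top=\Sigma_w$, and finite Fisher information $\mathtt J(p)=\int\nabla\log p(w)[\nabla\log p(w)]^\top p(w)\,dw$. (A2) $Q\succ0$, $R\succ0$. (A3) The system is stabilizable at $\theta$. (A4) $\mathrm{vec}\,B(\theta)=L\theta+\mathrm{vec}\,B_0$ with $L\in\mathbb R^{d_xd_u\times d_\theta}$, $B_0\in\mathbb R^{d_x\times d_u}$. A tuple $(\theta,A,B(\cdot),Q,R,p)$ satisfying these is called an instance. $P(\theta)$ is the stabilizing solution of $P=Q+A^\top PA-A^\top PB(R+B^\top PB)^{-1}B^\top PA$ with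 $B=B(\theta)$, and $K(\theta)=-(R+B^\top PB)^{-1}B^\top PA$ is the optimal stationary feedback, $u_t=K(\theta)x_t$. Let $\mathtt I_*^T(\theta)=\mathbf E\sum_{t=0}^T[\mathsf D_\theta[B(\theta)u_t]]^\top\mathtt J(p)\,\mathsf D_\theta[B(\theta)u_t]$, where $u_t=K(\theta)x_t$ is held fixed under differentiation (only $B(\theta)$ is differentiated) and $x_{t+1}=(A+B(\theta)K(\theta))x_t+w_t$, $x_0=0$. The instance is uninformative if (1) $\mathtt I_*^T(\theta)$ is singular for all $T$, and (2) there exists a vector $\tilde v$ in the nullspace of $\mathtt I_*^T(\theta)$ (for all $T$) such that $\mathsf D_\theta\mathrm{vec}K(\theta)\,\tilde v\ne0$. $\mathsf D_\theta$ is the Jacobian, $\otimes$ the Kronecker product, $\mathrm{vec}$ stacks columns. *)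

theory Defs
  imports "HOL-Probability.Probability"
begin

subsection \<open>Matrices\<close>

text \<open>Matrices are vectors of rows: \<^typ>\<open>real^'n^'m\<close> has row index \<^typ>\<open>'m\<close> and column index
  \<^typ>\<open>'n\<close>. A stacked vector is indexed by pairs (column, row), the column being the major index;
  the Kronecker product uses the same (block, position within block) indexing on both sides.\<close>

definition vectorize :: "'a^'n^'m \<Rightarrow> 'a^('n \<times> 'm)"
  where "vectorize X = (\<chi> k. X $ snd k $ fst k)"

definition kronecker :: "'a::times^'n^'m \<Rightarrow> 'a^'q^'p \<Rightarrow> 'a^('n \<times> 'q)^('m \<times> 'p)"  (infixl "\<otimes>\<^sub>K" 70)
  where "X \<otimes>\<^sub>K Y = (\<chi> i j. X $ fst i $ fst j * Y $ snd i $ snd j)"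

lemma kronecker_mult_vectorize:
  fixes X :: "real^'n^'m" and Y :: "real^'q^'p" and Z :: "real^'n^'q"
  shows "(X \<otimes>\<^sub>K Y) *v vectorize Z = vectorize (Y ** Z ** transpose X)"
proof -
  have "(\<Sum>j\<in>UNIV. X $ fst i $ fst j * Y $ snd i $ snd j * Z $ snd j $ fst j) =
      (\<Sum>k\<in>UNIV. (\<Sum>l\<in>UNIV. Y $ snd i $ l * Z $ l $ k) * X $ fst i $ k)" for i
    by (simp add: UNIV_Times_UNIV[symmetric] sum.cartesian_product' sum_distrib_left sum_distrib_right mult_ac
        del: UNIV_Times_UNIV)
  then show ?thesis
    by (simp add: vec_eq_iff matrix_vector_mult_def matrix_matrix_mult_def kronecker_def
        vectorize_def transpose_def)
qed

definition outer :: "real^'n \<Rightarrow> real^'n^'n"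
  where "outer v = columnvector v ** (rowvector v :: real^'n^1)"

lemma outer_nth: "outer v $ i $ j = v $ i * v $ j"
  by (simp add: outer_def columnvector_def rowvector_def matrix_matrix_mult_def)

definition positive_definite :: "real^'n^'n \<Rightarrow> bool"
  where "positive_definite M \<longleftrightarrow> transpose M = M \<and> (\<forall>v. v \<noteq> 0 \<longrightarrow> v \<bullet> (M *v v) > 0)"

text \<open>All complex eigenvalues lie in the open unit disc.\<close>

definition schur_stable :: "real^'n^'n \<Rightarrow> bool"
  where "schur_stable M \<longleftrightarrow>
    (\<forall>(z::complex) (v::complex^'n).
       v \<noteq> 0 \<and> map_matrix complex_of_real M *v v = z *s v \<longrightarrow> norm z < 1)"

subsection \<open>Linear quadratic regulation\<close>

definition stabilizable :: "real^'x^'x \<Rightarrow> real^'u^'x \<Rightarrow> bool"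
  where "stabilizable A B \<longleftrightarrow> (\<exists>F :: real^'x^'u. schur_stable (A + B ** F))"

definition riccati_gain :: "real^'x^'x \<Rightarrow> real^'u^'x \<Rightarrow> real^'u^'u \<Rightarrow> real^'x^'x \<Rightarrow> real^'x^'u"
  where "riccati_gain A B R P =
    - (matrix_inv (R + transpose B ** P ** B) ** transpose B ** P ** A)"

definition stabilizing_solution ::
    "real^'x^'x \<Rightarrow> real^'u^'x \<Rightarrow> real^'x^'x \<Rightarrow> real^'u^'u \<Rightarrow> real^'x^'x \<Rightarrow> bool"
  where "stabilizing_solution A B Q R P \<longleftrightarrow>
    transpose P = P \<and>
    invertible (R + transpose B ** P ** B) \<and>
    P = Q + transpose A ** P ** A
          - transpose A ** P ** B ** matrix_inv (R + transpose B ** P ** B) ** transpose B ** P ** A \<and>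
    schur_stable (A + B ** riccati_gain A B R P)"

definition optimal_gain :: "real^'x^'x \<Rightarrow> real^'u^'x \<Rightarrow> real^'x^'x \<Rightarrow> real^'u^'u \<Rightarrow> real^'x^'u"
  where "optimal_gain A B Q R = riccati_gain A B R (THE P. stabilizing_solution A B Q R P)"

subsection \<open>Fisher information\<close>

definition gradient :: "('a::real_inner \<Rightarrow> real) \<Rightarrow> 'a \<Rightarrow> 'a"
  where "gradient f x = (THE g. GDERIV f x :> g)"

definition continuously_differentiable :: "('a::real_inner \<Rightarrow> real) \<Rightarrow> bool"
  where "continuously_differentiable f \<longleftrightarrow>
    (\<exists>g. (\<forall>x. GDERIV f x :> g x) \<and> continuous_on UNIV g)"

text \<open>Points with \<^prop>\<open>p w = 0\<close>, where the logarithm of \<^term>\<open>p\<close> has no meaning, contribute nothing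
  because of the factor \<^term>\<open>p w\<close>.\<close>

definition fisher_integrand :: "(real^'x \<Rightarrow> real) \<Rightarrow> real^'x \<Rightarrow> real^'x^'x"
  where "fisher_integrand p w = p w *\<^sub>R outer (gradient (\<lambda>z. ln (p z)) w)"

definition fisher_information :: "(real^'x \<Rightarrow> real) \<Rightarrow> real^'x^'x"
  where "fisher_information p = (LINT w|lborel. fisher_integrand p w)"

subsection \<open>Instances\<close>

locale lqr_instance = prob_space M
  for M :: "'s measure"
    and w :: "nat \<Rightarrow> 's \<Rightarrow> real^'x"
    and \<Theta> :: "(real^'p) set"
    and \<theta> :: "real^'p"
    and A :: "real^'x^'x"
    and B :: "real^'p \<Rightarrow> real^'u^'x"
    and Q :: "real^'x^'x"
    and R :: "real^'u^'u"
    and p :: "real^'x \<Rightarrow> real"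
    and \<Sigma>\<^sub>w :: "real^'x^'x"
    and L :: "real^'p^('u \<times> 'x)"
    and B\<^sub>0 :: "real^'u^'x" +
  assumes open_parameters: "open \<Theta>"
    and parameter: "\<theta> \<in> \<Theta>"
    and noise_indep: "indep_vars (\<lambda>_. borel) w UNIV"
    and noise_density: "\<And>t. distributed M lborel (w t) (\<lambda>z. ennreal (p z))"
    and density_nonneg: "\<And>z. 0 \<le> p z"
    and density_C1: "continuously_differentiable p"
    and noise_second_moment: "\<And>t. has_bochner_integral M (\<lambda>\<omega>. outer (w t \<omega>)) \<Sigma>\<^sub>w"
    and finite_fisher_information: "integrable lborel (fisher_integrand p)"
    and state_cost: "positive_definite Q"
    and input_cost: "positive_definite R"
    and stabilizable: "stabilizable A (B \<theta>)"
    and affine: "\<And>\<eta>. \<eta> \<in> \<Theta> \<Longrightarrow> vectorize (B \<eta>) = L *v \<eta> + vectorize B\<^sub>0"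

primrec state :: "real^'x^'x \<Rightarrow> (nat \<Rightarrow> 's \<Rightarrow> real^'x) \<Rightarrow> nat \<Rightarrow> 's \<Rightarrow> real^'x" where
  "state F w 0 \<omega> = 0"
| "state F w (Suc t) \<omega> = F *v state F w t \<omega> + w t \<omega>"

text \<open>The input \<^term>\<open>u\<close> is a constant in the Jacobian: only \<^term>\<open>B\<close> is differentiated.\<close>

definition information_increment ::
    "real^'p \<Rightarrow> (real^'p \<Rightarrow> real^'u^'x) \<Rightarrow> (real^'x \<Rightarrow> real) \<Rightarrow> real^'u \<Rightarrow> real^'p^'p"
  where "information_increment \<theta> B p u =
    (let D = jacobian (\<lambda>\<eta>. B \<eta> *v u) (at \<theta>) in transpose D ** fisher_information p ** D)"

definition optimal_information ::
    "'s measure \<Rightarrow> (nat \<Rightarrow> 's \<Rightarrow> real^'x) \<Rightarrow> real^'p \<Rightarrow> real^'x^'x \<Rightarrow> (real^'p \<Rightarrow> real^'u^'x) \<Rightarrow>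
     real^'x^'x \<Rightarrow> real^'u^'u \<Rightarrow> (real^'x \<Rightarrow> real) \<Rightarrow> nat \<Rightarrow> real^'p^'p"
  where "optimal_information M w \<theta> A B Q R p T =
    (let K = optimal_gain A (B \<theta>) Q R in
     LINT \<omega>|M. (\<Sum>t\<le>T. information_increment \<theta> B p (K *v state (A + B \<theta> ** K) w t \<omega>)))"

definition uninformative ::
    "'s measure \<Rightarrow> (nat \<Rightarrow> 's \<Rightarrow> real^'x) \<Rightarrow> real^'p \<Rightarrow> real^'x^'x \<Rightarrow> (real^'p \<Rightarrow> real^'u^'x) \<Rightarrow>
     real^'x^'x \<Rightarrow> real^'u^'u \<Rightarrow> (real^'x \<Rightarrow> real) \<Rightarrow> bool"
  where "uninformative M w \<theta> A B Q R p \<longleftrightarrow>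
    (\<forall>T. \<not> invertible (optimal_information M w \<theta> A B Q R p T)) \<and>
    (\<exists>v. (\<forall>T. optimal_information M w \<theta> A B Q R p T *v v = 0) \<and>
         jacobian (\<lambda>\<eta>. vectorize (optimal_gain A (B \<eta>) Q R)) (at \<theta>) *v v \<noteq> 0)"

end

theory Submission
  imports Defs
begin

text \<open>
  Write \<open>J\<close> for the Fisher information of the noise, \<open>K\<close> for the optimal gain at \<open>\<theta>\<close> and, for a
  direction \<open>v\<close>, let \<open>X\<close> be the matrix with \<open>vec X = L v\<close>, which is the derivative of \<open>B\<close> along \<open>v\<close>.
  Both null spaces in the equivalence are the set of those \<open>v\<close> with \<open>J X K = 0\<close>.

  For the algebraic one (\<open>kronecker_gram_kernel\<close>), the quadratic form of \<open>L\<^sup>T (K K\<^sup>T \<otimes> J) L\<close> at \<open>v\<close>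
  is the sum of \<open>c\<^sup>T J c\<close> over the columns \<open>c\<close> of \<open>X K\<close>. As \<open>J\<close> is symmetric and positive semidefinite,
  the sum vanishes only if \<open>J c = 0\<close> for each column.

  For the information matrices (\<open>optimal_information_kernel\<close>), the form of the increment at time \<open>t\<close> is
  \<open>(X K x\<^sub>t)\<^sup>T J (X K x\<^sub>t)\<close>, so \<open>J X K = 0\<close> puts \<open>v\<close> in every null space. Conversely the horizon 1 is
  enough: there \<open>x\<^sub>0 = 0\<close> and \<open>x\<^sub>1 = w\<^sub>0\<close>, so that \<open>J X K w\<^sub>0 = 0\<close> almost surely. A variable with a
  density almost surely avoids each proper subspace (\<open>noise_nondegenerate\<close>), hence \<open>J X K = 0\<close>.

  Finally, a direction on which the Jacobian of the gain does not vanish is nonzero, so its membership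
  in the null spaces already makes all information matrices singular.
\<close>

section \<open>Null spaces of integrals and of positive semidefinite matrices\<close>

text \<open>No integrability is needed: the integral of a function that is not integrable is 0.\<close>

lemma bounded_linear_integral_eq_0:
  fixes T :: "'b::{banach, second_countable_topology} \<Rightarrow> 'c::{banach, second_countable_topology}"
  assumes T: "bounded_linear T" and zero: "\<And>x. T (f x) = 0"
  shows "T (integral\<^sup>L M f) = 0"
proof (cases "integrable M f")
  case True
  then have "T (integral\<^sup>L M f) = (\<integral>x. T (f x) \<partial>M)"
    by (rule integral_bounded_linear[OF T, symmetric])
  then show ?thesis by (simp add: zero)
next
  case False
  then show ?thesis
    by (simp add: not_integrable_integral_eq linear_0[OF bounded_linear.linear[OF T]])
qed

lemma psd_kernel:
  fixes S :: "real^'n^'n"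
  assumes sym: "transpose S = S" and psd: "\<And>x. 0 \<le> x \<bullet> (S *v x)" and zero: "v \<bullet> (S *v v) = 0"
  shows "S *v v = 0"
proof -
  let ?y = "S *v v"
  have cross: "v \<bullet> (S *v ?y) = ?y \<bullet> ?y"
    by (metis dot_lmul_matrix sym transpose_matrix_vector)
  have quad: "0 \<le> 2 * t * (?y \<bullet> ?y) + t\<^sup>2 * (?y \<bullet> (S *v ?y))" for t
  proof -
    have "(v + t *\<^sub>R ?y) \<bullet> (S *v (v + t *\<^sub>R ?y)) = 2 * t * (?y \<bullet> ?y) + t\<^sup>2 * (?y \<bullet> (S *v ?y))"
      by (simp add: matrix_vector_right_distrib matrix_vector_mult_scaleR inner_add_left
          inner_add_right cross zero power2_eq_square algebra_simps)
    then show ?thesis using psd[of "v + t *\<^sub>R ?y"] by simp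
  qed
  define c where "c = ?y \<bullet> (S *v ?y)"
  define b where "b = ?y \<bullet> ?y"
  have c0: "c \<ge> 0" unfolding c_def by (rule psd)
  \<comment> \<open>The quadratic polynomial in \<open>t\<close> of \<open>quad\<close> is negative at \<open>- b / (c + 1)\<close> unless \<open>b = 0\<close>.\<close>
  define s where "s = b / (c + 1)"
  have b_eq: "b = s * (c + 1)" using c0 by (simp add: s_def)
  have "0 \<le> 2 * (- s) * b + (- s)\<^sup>2 * c"
    using quad[of "- s"] by (simp only: b_def c_def)
  also have "\<dots> = - (s\<^sup>2 * (c + 2))"
    by (simp add: b_eq power2_eq_square algebra_simps)
  finally have "s\<^sup>2 * (c + 2) \<le> 0" by simp
  with c0 have "s = 0" by (simp add: mult_le_0_iff)
  then show ?thesis using b_eq by (simp add: b_def)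
qed

section \<open>Vectorization and Kronecker products\<close>

text \<open>The inverse of \<^const>\<open>vectorize\<close>, with the same (column, row) order of the index pairs.\<close>

definition unvectorize :: "'a^('n \<times> 'm) \<Rightarrow> 'a^'n^'m"
  where "unvectorize x = (\<chi> i j. x $ (j, i))"

lemma vectorize_unvectorize [simp]: "vectorize (unvectorize x) = x"
  by (simp add: vectorize_def unvectorize_def vec_eq_iff)

lemma unvectorize_vectorize [simp]: "unvectorize (vectorize X) = X"
  by (simp add: vectorize_def unvectorize_def vec_eq_iff)

lemma linear_unvectorize: "linear (unvectorize :: real^('n \<times> 'm) \<Rightarrow> real^'n^'m)"
  by (rule linearI) (simp_all add: unvectorize_def vec_eq_iff)

lemma inner_vectorize: "vectorize X \<bullet> vectorize Y = X \<bullet> (Y :: real^'n^'m)"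
proof -
  have "vectorize X \<bullet> vectorize Y = (\<Sum>j\<in>UNIV. \<Sum>i\<in>UNIV. X $ i $ j * Y $ i $ j)"
    by (simp add: inner_vec_def vectorize_def UNIV_Times_UNIV[symmetric] sum.cartesian_product'
        del: UNIV_Times_UNIV)
  also have "\<dots> = X \<bullet> Y"
    by (subst sum.swap) (simp add: inner_vec_def)
  finally show ?thesis .
qed

lemma inner_matrix_columns:
  fixes X Y :: "real^'n^'m"
  shows "X \<bullet> Y = (\<Sum>j\<in>UNIV. column j X \<bullet> column j Y)"
  unfolding inner_vec_def column_def by (subst sum.swap) simp

lemma inner_transpose_mult: "x \<bullet> (transpose N *v y) = (N *v x) \<bullet> (y::real^'m)"
  by (metis dot_lmul_matrix inner_commute transpose_matrix_vector)

text \<open>Inner products of matrices are Frobenius products.\<close>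

lemma inner_matrix_mult_transpose: "X \<bullet> (Y ** transpose Z) = (X ** Z) \<bullet> (Y :: real^'n^'m)"
proof -
  have 1: "(Y ** transpose Z) $ i = Z *v (Y $ i)" for i
    by (simp add: vec_eq_iff matrix_matrix_mult_def matrix_vector_mult_def transpose_def mult.commute)
  have 2: "(X ** Z) $ i = transpose Z *v (X $ i)" for i
    by (simp add: vec_eq_iff matrix_matrix_mult_def vector_matrix_mult_def mult.commute)
  have "X $ i \<bullet> (Y ** transpose Z) $ i = (X ** Z) $ i \<bullet> Y $ i" for i
    unfolding 1 2 by (metis inner_commute inner_transpose_mult)
  then show ?thesis
    by (subst (1 2) inner_vec_def) simp
qed

lemma column_matrix_mult: "column j (X ** Y) = X *v column j (Y::real^'n^'m)"
  by (simp add: column_def matrix_matrix_mult_def matrix_vector_mult_def vec_eq_iff)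

lemma matrix_add_rdistrib: "(X + Y) ** Z = X ** Z + Y ** (Z::real^'n^'m)"
  by (simp add: matrix_matrix_mult_def vec_eq_iff distrib_right sum.distrib)

lemma kronecker_add_left: "(X + Y) \<otimes>\<^sub>K Z = X \<otimes>\<^sub>K Z + Y \<otimes>\<^sub>K (Z::real^'n^'m)"
  by (simp add: kronecker_def vec_eq_iff algebra_simps)

lemma kronecker_scaleR_left: "(c *\<^sub>R X) \<otimes>\<^sub>K Z = c *\<^sub>R (X \<otimes>\<^sub>K (Z::real^'n^'m))"
  by (simp add: kronecker_def vec_eq_iff)

text \<open>With \<open>vec X = L v\<close>, the quadratic form at \<open>v\<close> is the Frobenius product of \<open>X K\<close> and \<open>J X K\<close>,
  which splits into the values of the form of \<open>J\<close> at the columns of \<open>X K\<close>.\<close>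

lemma kronecker_gram_kernel:
  fixes L :: "real^'p^('u::finite \<times> 'x::finite)" and J :: "real^'x^'x" and K :: "real^'n^'u"
  assumes sym: "transpose J = J" and psd: "\<And>x. 0 \<le> x \<bullet> (J *v x)"
  shows "(transpose L ** ((K ** transpose K) \<otimes>\<^sub>K J) ** L) *v v = 0 \<longleftrightarrow>
    J ** unvectorize (L *v v) ** K = 0"
proof -
  define X where "X = unvectorize (L *v v)"
  have Lv: "L *v v = vectorize X" by (simp add: X_def)
  have app: "(transpose L ** ((K ** transpose K) \<otimes>\<^sub>K J) ** L) *v v =
      transpose L *v vectorize (J ** X ** K ** transpose K)"
    by (simp add: matrix_vector_mul_assoc[symmetric] Lv kronecker_mult_vectorize
        matrix_transpose_mul matrix_mul_assoc)
  show ?thesis unfolding X_def[symmetric]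
  proof
    assume "(transpose L ** ((K ** transpose K) \<otimes>\<^sub>K J) ** L) *v v = 0"
    then have "v \<bullet> (transpose L *v vectorize (J ** X ** K ** transpose K)) = 0"
      by (simp add: app)
    then have "vectorize X \<bullet> vectorize (J ** X ** K ** transpose K) = 0"
      by (metis Lv dot_lmul_matrix inner_commute transpose_matrix_vector transpose_transpose)
    then have "(X ** K) \<bullet> (J ** (X ** K)) = 0"
      by (simp add: inner_vectorize inner_matrix_mult_transpose matrix_mul_assoc)
    then have "(\<Sum>j\<in>UNIV. column j (X ** K) \<bullet> (J *v column j (X ** K))) = 0"
      by (simp add: inner_matrix_columns column_matrix_mult)
    then have "column j (X ** K) \<bullet> (J *v column j (X ** K)) = 0" for j
      by (simp add: sum_nonneg_eq_0_iff psd)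
    then have "column j (J ** X ** K) = 0" for j
      using psd_kernel[OF sym psd] by (simp add: column_matrix_mult matrix_mul_assoc[symmetric])
    then show "J ** X ** K = 0" by (simp add: column_def vec_eq_iff)
  next
    assume "J ** X ** K = 0"
    then have "vectorize (J ** X ** K ** transpose K) = 0"
      by (simp add: vectorize_def) (simp add: vec_eq_iff)
    then show "(transpose L ** ((K ** transpose K) \<otimes>\<^sub>K J) ** L) *v v = 0"
      by (simp only: app matrix_vector_mult_0_right)
  qed
qed

section \<open>Outer products and the Fisher information\<close>

lemma outer_mult_vector: "outer g *v x = (g \<bullet> x) *\<^sub>R g"
  by (simp add: inner_vec_def matrix_vector_mult_def outer_nth vec_eq_iff sum_distrib_left mult_ac)

lemma outer_matrix_vector: "outer (N *v v) = N ** outer v ** transpose N"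
proof -
  have "outer (N *v v) *v x = (N ** outer v ** transpose N) *v x" for x
    by (simp only: matrix_vector_mul_assoc[symmetric] outer_mult_vector inner_transpose_mult
        matrix_vector_mult_scaleR)
  then show ?thesis by (simp add: matrix_eq)
qed

lemma transpose_outer: "transpose (outer v) = outer v"
  by (simp add: transpose_def outer_nth vec_eq_iff mult.commute)

lemma inner_matrix_mult_outer: "X \<bullet> (Y ** outer u) = (X *v u) \<bullet> (Y *v u)"
proof -
  have "(Y ** outer u) $ i = (Y $ i \<bullet> u) *\<^sub>R u" for i
    by (simp add: vec_eq_iff matrix_matrix_mult_def outer_nth inner_vec_def sum_distrib_left
        sum_distrib_right mult_ac)
  then show ?thesis
    by (subst (1 2) inner_vec_def) (simp add: matrix_vector_mul_component mult.commute)
qed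

lemma fisher_information_symmetric:
  assumes "integrable lborel (fisher_integrand p)"
  shows "transpose (fisher_information p) = fisher_information p"
proof -
  have bl: "bounded_linear (transpose :: real^'n^'n \<Rightarrow> real^'n^'n)"
    unfolding linear_conv_bounded_linear[symmetric]
    by (rule linearI) (simp_all add: transpose_def vec_eq_iff)
  have "transpose (fisher_integrand p z) = fisher_integrand p z" for z
    by (simp add: fisher_integrand_def transpose_scalar transpose_outer)
  then show ?thesis
    unfolding fisher_information_def by (simp add: integral_bounded_linear[OF bl assms, symmetric])
qed

lemma bounded_linear_quadratic_form: "bounded_linear (\<lambda>X::real^'n^'n. x \<bullet> (X *v x))"
  unfolding linear_conv_bounded_linear[symmetric]
  by (rule linearI) (simp_all add: matrix_vector_mult_add_rdistrib inner_add_right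
      scaleR_matrix_vector_assoc[symmetric])

lemma fisher_information_psd:
  assumes "integrable lborel (fisher_integrand p)" "\<And>z. 0 \<le> p z"
  shows "0 \<le> x \<bullet> (fisher_information p *v x)"
proof -
  have "x \<bullet> (fisher_information p *v x) = (\<integral>z. x \<bullet> (fisher_integrand p z *v x) \<partial>lborel)"
    unfolding fisher_information_def
    by (rule integral_bounded_linear[OF bounded_linear_quadratic_form assms(1), symmetric])
  also have "\<dots> \<ge> 0"
    by (rule integral_nonneg_AE) (simp add: fisher_integrand_def scaleR_matrix_vector_assoc[symmetric]
       outer_mult_vector inner_commute assms(2) mult.assoc
       power2_eq_square[symmetric])
  finally show ?thesis .
qed

section \<open>The information of an instance\<close>

context lqr_instance
begin

text \<open>\<^term>\<open>B\<close> is known to be affine only on \<^term>\<open>\<Theta>\<close>, which is open and contains \<^term>\<open>\<theta>\<close>.\<close>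

lemma jacobian_input_mult:
  "jacobian (\<lambda>\<eta>. B \<eta> *v u) (at \<theta>) *v v = unvectorize (L *v v) *v u"
proof -
  have lin: "linear (\<lambda>v. unvectorize (L *v v) *v u)"
    by (rule linearI) (simp_all add: linear_add[OF linear_unvectorize]
       linear_cmul[OF linear_unvectorize]
       matrix_vector_right_distrib matrix_vector_mult_add_rdistrib matrix_vector_mult_scaleR
       scaleR_matrix_vector_assoc[symmetric])
  have "((\<lambda>\<eta>. unvectorize (L *v \<eta>) *v u + B\<^sub>0 *v u) has_derivative
      (\<lambda>v. unvectorize (L *v v) *v u)) (at \<theta>)"
    using has_derivative_add[OF bounded_linear_imp_has_derivative has_derivative_const]
     lin by (fastforce simp: linear_conv_bounded_linear)
  moreover have "unvectorize (L *v \<eta>) *v u + B\<^sub>0 *v u = B \<eta> *v u" if "\<eta> \<in> \<Theta>" for \<eta>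
  proof -
    have "B \<eta> = unvectorize (L *v \<eta> + vectorize B\<^sub>0)"
      by (metis affine[OF that] unvectorize_vectorize)
    then show ?thesis by (simp add: linear_add[OF linear_unvectorize] matrix_vector_mult_add_rdistrib)
  qed
  ultimately have "((\<lambda>\<eta>. B \<eta> *v u) has_derivative (\<lambda>v. unvectorize (L *v v) *v u)) (at \<theta>)"
    by (rule has_derivative_transform_within_open[OF _ open_parameters parameter])
  then have "frechet_derivative (\<lambda>\<eta>. B \<eta> *v u) (at \<theta>) = (\<lambda>v. unvectorize (L *v v) *v u)"
    by (rule frechet_derivative_at[symmetric])
  then show ?thesis
    by (simp add: jacobian_def matrix_works[OF iffD2[OF linear_matrix_vector_mul_eq lin]])
qed

lemma information_increment_mult:
  "v' \<bullet> (information_increment \<theta> B p u *v v) =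
    (unvectorize (L *v v') *v u) \<bullet> (fisher_information p *v (unvectorize (L *v v) *v u))"
  unfolding information_increment_def Let_def
  by (simp only: matrix_vector_mul_assoc[symmetric] jacobian_input_mult inner_transpose_mult)

text \<open>The increment is a linear function of \<^term>\<open>outer u\<close>; its integrability for noise-driven inputs
  thus reduces to the second moment of the noise.\<close>

lemma information_increment_eq:
  "information_increment \<theta> B p u = transpose L ** (outer u \<otimes>\<^sub>K fisher_information p) ** L"
proof -
  have "transpose L *v vectorize (fisher_information p ** unvectorize (L *v v) ** outer u) =
      information_increment \<theta> B p u *v v" for v
  proof (rule vector_eq_ldot[THEN iffD1], rule allI)
    fix y
    let ?X = "\<lambda>v. unvectorize (L *v v)"
    have "y \<bullet> (transpose L *v vectorize (fisher_information p ** ?X v ** outer u)) =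
        vectorize (?X y) \<bullet> vectorize (fisher_information p ** ?X v ** outer u)"
      by (simp only: inner_transpose_mult vectorize_unvectorize)
    also have "\<dots> = (?X y *v u) \<bullet> ((fisher_information p ** ?X v) *v u)"
      by (simp only: inner_vectorize inner_matrix_mult_outer)
    also have "\<dots> = y \<bullet> (information_increment \<theta> B p u *v v)"
      by (simp add: information_increment_mult matrix_vector_mul_assoc)
    finally show "y \<bullet> (transpose L *v vectorize (fisher_information p ** ?X v ** outer u)) =
        y \<bullet> (information_increment \<theta> B p u *v v)" .
  qed
  then have "(transpose L ** (outer u \<otimes>\<^sub>K fisher_information p) ** L) *v v =
      information_increment \<theta> B p u *v v" for v
    using kronecker_mult_vectorize[of "outer u" "fisher_information p" "unvectorize (L *v v)"]
    by (simp add: matrix_vector_mul_assoc[symmetric] transpose_outer)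
  then show ?thesis
    by (simp add: matrix_eq)
qed

lemma information_increment_kernel:
  assumes "fisher_information p ** unvectorize (L *v v) ** N = 0"
  shows "information_increment \<theta> B p (N *v x) *v v = 0"
proof -
  have "fisher_information p *v (unvectorize (L *v v) *v (N *v x)) = 0"
    by (simp add: matrix_vector_mul_assoc matrix_mul_assoc assms)
  then have "y \<bullet> (information_increment \<theta> B p (N *v x) *v v) = 0" for y
    by (simp add: information_increment_mult)
  then show ?thesis using inner_eq_zero_iff by blast
qed

lemma integrable_information_increment:
  "integrable M (\<lambda>\<omega>. information_increment \<theta> B p (N *v w t \<omega>))"
proof -
  let ?F = "\<lambda>X. transpose L ** ((N ** X ** transpose N) \<otimes>\<^sub>K fisher_information p) ** L"
  have "bounded_linear ?F"
    unfolding linear_conv_bounded_linear[symmetric]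
    by (rule linearI) (simp_all add: matrix_add_ldistrib matrix_add_rdistrib kronecker_add_left
       kronecker_scaleR_left matrix_scalar_ac scalar_matrix_assoc[symmetric])
  then have "integrable M (\<lambda>\<omega>. ?F (outer (w t \<omega>)))"
    using noise_second_moment[of t] integrable_bounded_linear has_bochner_integral_iff by blast
  then show ?thesis
    by (simp add: information_increment_eq outer_matrix_vector)
qed

text \<open>A noise vector lies in a proper subspace with probability 0, because it has a density.\<close>

lemma noise_nondegenerate:
  fixes N :: "real^'x^'n"
  assumes "AE \<omega> in M. N *v w t \<omega> = 0"
  shows "N = 0"
proof (rule ccontr)
  assume "N \<noteq> 0"
  let ?S = "{z. N *v z = 0}"
  have sub: "subspace ?S"
    by (simp add: subspace_def matrix_vector_right_distrib matrix_vector_mult_scaleR)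
  have "?S \<noteq> UNIV"
  proof
    assume "?S = UNIV"
    then have "N *v z = 0 *v z" for z by auto
    then have "N = 0" by (simp add: matrix_eq)
    with \<open>N \<noteq> 0\<close> show False by simp
  qed
  then have "dim ?S < DIM(real^'x)"
    by (metis dim_eq_full dim_subset_UNIV le_neq_implies_less sub span_eq_iff)
  then have "negligible ?S" by (rule negligible_lowdim)
  then have "AE z in lebesgue. z \<notin> ?S"
    by (auto simp: negligible_iff_null_sets dest: AE_not_in)
  then have "AE z in lborel. z \<notin> ?S"
    by (subst (asm) AE_completion_iff) simp_all
  then have "AE z in density lborel (\<lambda>z. ennreal (p z)). z \<notin> ?S"
    using noise_density[of t] by (subst AE_density) (auto simp: distributed_def)
  then have "AE z in distr M lborel (w t). z \<notin> ?S"
    unfolding distributed_distr_eq_density[OF noise_density[of t]] .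
  then have "AE \<omega> in M. w t \<omega> \<notin> ?S"
    using noise_density[of t] by (intro AE_distrD[of "w t" M lborel]) (auto simp: distributed_def)
  then have "AE \<omega> in M. False" using assms by eventually_elim auto
  then show False by simp
qed

lemma optimal_information_kernel:
  "(\<forall>T. optimal_information M w \<theta> A B Q R p T *v v = 0) \<longleftrightarrow>
    fisher_information p ** unvectorize (L *v v) ** optimal_gain A (B \<theta>) Q R = 0"
proof
  let ?K = "optimal_gain A (B \<theta>) Q R" and ?J = "fisher_information p"
  let ?X = "unvectorize (L *v v)"
  let ?x = "state (A + B \<theta> ** ?K) w"
  assume "?J ** ?X ** ?K = 0"
  have "(\<lambda>X. X *v v) (\<integral>\<omega>. (\<Sum>t\<le>T. information_increment \<theta> B p (?K *v ?x t \<omega>)) \<partial>M) = 0" for T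
  proof (rule bounded_linear_integral_eq_0)
    show "bounded_linear (\<lambda>X::real^'p^'p. X *v v)"
      unfolding linear_conv_bounded_linear[symmetric]
      by (rule linearI) (simp_all add: matrix_vector_mult_add_rdistrib scaleR_matrix_vector_assoc)
    show "(\<Sum>t\<le>T. information_increment \<theta> B p (?K *v ?x t \<omega>)) *v v = 0" for \<omega>
      \<comment> \<open>The state is kept folded, so that each summand has the form of \<open>information_increment_kernel\<close>.\<close>
      by (induction T) (simp_all del: state.simps add: matrix_vector_mult_add_rdistrib
          information_increment_kernel[OF \<open>?J ** ?X ** ?K = 0\<close>])
  qed
  then show "\<forall>T. optimal_information M w \<theta> A B Q R p T *v v = 0"
    by (simp add: optimal_information_def Let_def)
next
  let ?K = "optimal_gain A (B \<theta>) Q R" and ?J = "fisher_information p"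
  let ?X = "unvectorize (L *v v)"
  let ?inc = "\<lambda>\<omega>. information_increment \<theta> B p (?K *v w 0 \<omega>)"
  note sym = fisher_information_symmetric[OF finite_fisher_information]
   and psd = fisher_information_psd[OF finite_fisher_information density_nonneg]
  assume "\<forall>T. optimal_information M w \<theta> A B Q R p T *v v = 0"
  \<comment> \<open>Up to time 1 the only state that can be nonzero is \<open>x\<^sub>1 = w\<^sub>0\<close>, with input \<open>K w\<^sub>0\<close>.\<close>
  then have "optimal_information M w \<theta> A B Q R p 1 *v v = 0" by blast
  moreover have "optimal_information M w \<theta> A B Q R p 1 = (\<integral>\<omega>. ?inc \<omega> \<partial>M)"
  proof -
    have "information_increment \<theta> B p 0 = 0"
      using information_increment_kernel[where N = "0::real^'u^'u" and x = 0] by (simp add: matrix_eq)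
    then show ?thesis
      by (simp add: optimal_information_def Let_def)
  qed
  ultimately have "v \<bullet> ((\<integral>\<omega>. ?inc \<omega> \<partial>M) *v v) = 0" by simp
  then have "(\<integral>\<omega>. v \<bullet> (?inc \<omega> *v v) \<partial>M) = 0"
    by (simp add: integral_bounded_linear[OF bounded_linear_quadratic_form
          integrable_information_increment])
  moreover have "integrable M (\<lambda>\<omega>. v \<bullet> (?inc \<omega> *v v))"
    by (rule integrable_bounded_linear[OF bounded_linear_quadratic_form integrable_information_increment])
  ultimately have "AE \<omega> in M. v \<bullet> (?inc \<omega> *v v) = 0"
    by (subst (asm) integral_nonneg_eq_0_iff_AE) (auto simp: information_increment_mult psd)
  then have "AE \<omega> in M. (?J ** ?X ** ?K) *v w 0 \<omega> = 0"
  proof eventually_elim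
    case (elim \<omega>)
    then have "?J *v (?X *v (?K *v w 0 \<omega>)) = 0"
      by (intro psd_kernel[OF sym psd]) (simp add: information_increment_mult)
    then show ?case by (simp add: matrix_vector_mul_assoc matrix_mul_assoc)
  qed
  then show "?J ** ?X ** ?K = 0" by (rule noise_nondegenerate)
qed

end

section \<open>Characterization of uninformative instances\<close>

theorem proposition3:
  fixes M :: "'s measure"
    and w :: "nat \<Rightarrow> 's \<Rightarrow> real^'x"
    and \<Theta> :: "(real^'p) set"
    and \<theta> :: "real^'p"
    and A :: "real^'x^'x"
    and B :: "real^'p \<Rightarrow> real^'u^'x"
    and Q :: "real^'x^'x"
    and R :: "real^'u^'u"
    and p :: "real^'x \<Rightarrow> real"
    and \<Sigma>\<^sub>w :: "real^'x^'x"
    and L :: "real^'p^('u \<times> 'x)"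
    and B\<^sub>0 :: "real^'u^'x"
    and K :: "real^'p \<Rightarrow> real^'x^'u"
  assumes "lqr_instance M w \<Theta> \<theta> A B Q R p \<Sigma>\<^sub>w L B\<^sub>0"
    and "K = (\<lambda>\<eta>. optimal_gain A (B \<eta>) Q R)"
  shows "uninformative M w \<theta> A B Q R p \<longleftrightarrow>
    (\<exists>v :: real^'p.
       (transpose L ** ((K \<theta> ** transpose (K \<theta>)) \<otimes>\<^sub>K fisher_information p) ** L) *v v = 0 \<and>
       jacobian (\<lambda>\<eta>. vectorize (K \<eta>)) (at \<theta>) *v v \<noteq> 0)"
proof -
  interpret lqr_instance M w \<Theta> \<theta> A B Q R p \<Sigma>\<^sub>w L B\<^sub>0 by (rule assms(1))
  let ?D = "jacobian (\<lambda>\<eta>. vectorize (K \<eta>)) (at \<theta>)"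
  have kernel: "(\<forall>T. optimal_information M w \<theta> A B Q R p T *v v = 0) \<longleftrightarrow>
      (transpose L ** ((K \<theta> ** transpose (K \<theta>)) \<otimes>\<^sub>K fisher_information p) ** L) *v v = 0" for v
    using optimal_information_kernel[of v]
      kronecker_gram_kernel[OF fisher_information_symmetric[OF finite_fisher_information]
        fisher_information_psd[OF finite_fisher_information density_nonneg], of L "K \<theta>" v]
    by (simp add: assms(2))
  have singular: "\<not> invertible (optimal_information M w \<theta> A B Q R p T)"
    if "optimal_information M w \<theta> A B Q R p T *v v = 0" "?D *v v \<noteq> 0" for T v
  proof -
    from that(2) have "v \<noteq> 0" by auto
    with that(1) show ?thesis
      by (metis inj_matrix_vector_mult injD matrix_vector_mult_0_right)
  qed
  show ?thesis
    unfolding uninformative_def kernel[symmetric] assms(2)[symmetric]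
    using singular assms(2) by blast
qed

end
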